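(* For each integer $\nu\ge 3$, let $X_{\nu}$ be a (Student's) $t$-random variable with $\nu$ degrees of freedom, and let $Z$ be a standard normal random variable. Then, for every integer $\nu\ge 3$, $$P\left\{|X_{\nu}-E[X_{\nu}]|\le \sqrt{\mathrm{Var}(X_{\nu})}\right\}>P\{|Z|\le 1\}\approx 0.6827,$$ and $$\inf_{\nu\in\mathbb{N},\,\nu\ge 3}P\left\{|X_{\nu}-E[X_{\nu}]|\le \sqrt{\mathrm{Var}(X_{\nu})}\right\}=P\{|Z|\le 1\}.$$
   Context: A $t$-random variable with $\nu$ degrees of freedom has density $f_{\nu}(x)=\frac{\Gamma(\frac{\nu+1}{2})}{\sqrt{\nu\pi}\,\Gamma(\frac{\nu}{2})}\left(1+\frac{x^2}{\nu}\right)^{-\frac{\nu+1}{2}}$, $x\in\mathbb{R}$. The symbol $\approx$ means equality after rounding to the number of decimals displayed. *)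

theory Defs
  imports "HOL-Probability.Probability"
begin

definition student_t_density :: "real \<Rightarrow> real \<Rightarrow> real" where
  "student_t_density \<nu> x =
     Gamma ((\<nu> + 1) / 2) / (sqrt (\<nu> * pi) * Gamma (\<nu> / 2)) *
     (1 + x\<^sup>2 / \<nu>) powr (- ((\<nu> + 1) / 2))"

definition round_decimals :: "nat \<Rightarrow> real \<Rightarrow> real" where
  "round_decimals d x = of_int (round (x * 10 ^ d)) / 10 ^ d"

end

theory Submission
  imports Defs "HOL-Real_Asymp.Real_Asymp"
begin

text \<open>A \<open>t\<close> variable with \<open>\<nu>\<close> degrees of freedom, divided by its standard deviation, is a scale mixture
  of centred normal variables: given \<open>W = w\<close> it has variance \<open>1 / w\<close>, where \<open>W\<close> is Gamma distributed
  with shape \<open>\<nu> / 2\<close> and rate \<open>\<nu> / 2 - 1\<close>, so that \<open>E[1 / W] = 1\<close> and \<open>E[W] = \<nu> / (\<nu> - 2)\<close>. With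
  \<open>\<psi>(r) = P(|Z| \<le> r)\<close>, the probability in question is \<open>E[\<psi>(\<surd>W)]\<close>. The function \<open>u \<mapsto> \<psi>(1 / \<surd>u)\<close>
  is not convex, but it lies strictly above its tangent at \<open>u = 1\<close> elsewhere on \<open>u > 0\<close>; the supporting line
  form of Jensen's inequality gives \<open>E[\<psi>(\<surd>W)] > \<psi>(1)\<close>. On the other hand \<open>w \<mapsto> \<psi>(\<surd>w)\<close> lies below
  its tangent at \<open>w = 1\<close>, which gives \<open>E[\<psi>(\<surd>W)] \<le> \<psi>(1) + 2 \<phi>(1) / (\<nu> - 2)\<close>, where \<open>\<phi>\<close> is the
  standard normal density.\<close>

subsection \<open>Central probabilities of the standard normal distribution\<close>

text \<open>This is the function \<open>\<psi>\<close> of the overview. As the measure of an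
  interval it is total, with value 0 for negative \<open>r\<close>, and monotonicity, measurability
  and the bound by 1 come at once.\<close>

definition std_normal_central :: "real \<Rightarrow> real" where
  "std_normal_central r = measure (density lborel std_normal_density) {-r..r}"

lemma emeasure_std_normal_central:
  "emeasure (density lborel std_normal_density) {-r..r} = ennreal (std_normal_central r)"
proof -
  interpret prob_space "density lborel std_normal_density"
    by (rule prob_space_normal_density) simp
  show ?thesis by (simp add: std_normal_central_def emeasure_eq_measure)
qed

lemma std_normal_central_mono: "r \<le> s \<Longrightarrow> std_normal_central r \<le> std_normal_central s"
proof -
  interpret prob_space "density lborel std_normal_density"
    by (rule prob_space_normal_density) simp
  show "r \<le> s \<Longrightarrow> ?thesis"
    unfolding std_normal_central_def by (intro finite_measure_mono) auto
qed

lemma std_normal_central_nonneg: "0 \<le> std_normal_central r"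
  by (simp add: std_normal_central_def)

lemma std_normal_central_le_1: "std_normal_central r \<le> 1"
proof -
  interpret prob_space "density lborel std_normal_density"
    by (rule prob_space_normal_density) simp
  show ?thesis by (simp add: std_normal_central_def)
qed

lemma borel_measurable_std_normal_central [measurable]:
  "std_normal_central \<in> borel_measurable borel"
  by (intro borel_measurable_mono monoI std_normal_central_mono)

lemma continuous_on_std_normal_density: "continuous_on A std_normal_density"
  unfolding std_normal_density_def by (intro continuous_intros) auto

lemma std_normal_central_eq_integral: "std_normal_central r = integral {-r..r} std_normal_density"
proof -
  have "(std_normal_density has_integral integral {-r..r} std_normal_density) {-r..r}"
    by (intro integrable_integral integrable_continuous_real continuous_on_std_normal_density)
  then have "(\<integral>\<^sup>+x. ennreal (std_normal_density x) * indicator {-r..r} x \<partial>lborel)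
      = ennreal (integral {-r..r} std_normal_density)"
    by (rule nn_integral_has_integral_lebesgue'[rotated]) simp
  then have "emeasure (density lborel std_normal_density) {-r..r}
      = ennreal (integral {-r..r} std_normal_density)"
    by (simp add: emeasure_density)
  then show ?thesis
    by (simp add: std_normal_central_def measure_def integral_nonneg integrable_continuous_real
        continuous_on_std_normal_density)
qed

text \<open>Both end points of the interval move with \<open>r\<close>, and since the density is
  even they contribute equally. At 0 there is a kink, the function being 0 on the negative axis;
  hence the restriction to positive \<open>r\<close>.\<close>

lemma DERIV_std_normal_central:
  assumes "0 < r"
  shows "(std_normal_central has_real_derivative 2 * std_normal_density r) (at r)"
proof -
  \<comment> \<open>A base point \<open>-R\<close> to the left of \<open>-r\<close> makes both
    \<open>r\<close> and \<open>-r\<close> interior points, so the antiderivative \<open>S\<close>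
    has a two-sided derivative at each.\<close>
  define R where "R = r + 1"
  define S where "S x = integral {-R..x} std_normal_density" for x
  have S: "(S has_real_derivative std_normal_density x) (at x)" if "x \<in> {-R<..<R}" for x
  proof -
    have "(S has_real_derivative std_normal_density x) (at x within {-R..R})"
      unfolding S_def using that
      by (intro integral_has_real_derivative continuous_on_std_normal_density) auto
    then show ?thesis
      using that at_within_interior[of x "{-R..R}"] by simp
  qed
  have "((\<lambda>x. S x - S (- x)) has_real_derivative 2 * std_normal_density r) (at r)"
  proof -
    have 1: "(S has_real_derivative std_normal_density r) (at r)"
      by (rule S) (use assms in \<open>auto simp: R_def\<close>)
    have 2: "(S has_real_derivative std_normal_density (- r)) (at (- r))"
      by (rule S) (use assms in \<open>auto simp: R_def\<close>)
    have "((\<lambda>x. S (- x)) has_real_derivative std_normal_density (- r) * (- 1)) (at r)"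
      by (rule DERIV_chain2[where f = S and g = uminus and x = r, OF 2]) (auto intro!: derivative_eq_intros)
    from DERIV_diff[OF 1 this] show ?thesis by (simp add: std_normal_density_def)
  qed
  then show ?thesis
  proof (rule has_field_derivative_transform_within_open[where S = "{0<..<R}"])
    show "S x - S (- x) = std_normal_central x" if "x \<in> {0<..<R}" for x
    unfolding S_def std_normal_central_eq_integral
    using Henstock_Kurzweil_Integration.integral_combine[of "-R" "-x" x std_normal_density] that
    by (auto simp: integrable_continuous_real continuous_on_std_normal_density)
  qed (use assms in \<open>auto simp: R_def\<close>)
qed

section \<open>Tangent line bounds for the central probability\<close>

text \<open>Normalising by the value at the tangency point 1 lets that constant factor out of the
  derivatives below, whose signs then depend on elementary functions only.\<close>

lemma std_normal_density_eq_exp: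
  "std_normal_density x = std_normal_density 1 * exp (- (x\<^sup>2 - 1) / 2)"
  by (simp add: std_normal_density_def diff_divide_distrib flip: exp_add)

lemma std_normal_density_1_pos: "0 < std_normal_density 1"
  by (rule normal_density_pos) simp

text \<open>In the variable \<open>w = x\<^sup>2\<close> the right side is the tangent of
  \<open>std_normal_central (sqrt w)\<close> at \<open>w = 1\<close>. The difference
  \<open>D\<close> has derivative of the sign of \<open>x - exp (- (x\<^sup>2 - 1) / 2)\<close>,
  negative before 1 and positive after it, so 1 is its minimum.\<close>

lemma std_normal_central_le_tangent:
  assumes "0 < x"
  shows "std_normal_central x \<le> std_normal_central 1 + std_normal_density 1 * (x\<^sup>2 - 1)"
proof -
  define D where "D x = std_normal_density 1 * x\<^sup>2 - std_normal_central x" for x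
  have D: "(D has_real_derivative 2 * std_normal_density 1 * (x - exp (- (x\<^sup>2 - 1) / 2))) (at x)"
    if "0 < x" for x
    unfolding D_def
    by (rule derivative_eq_intros DERIV_std_normal_central that refl)+
      (simp add: algebra_simps std_normal_density_eq_exp[of x])
  have "D 1 \<le> D x"
  proof (cases "x \<le> 1")
    case True
    have *: "2 * std_normal_density 1 * (t - exp (- (t\<^sup>2 - 1) / 2)) \<le> 0" if "x \<le> t" "t \<le> 1" for t
    proof -
      have "t\<^sup>2 \<le> 1" using that assms by (simp add: power_le_one)
      then have "1 \<le> exp (- (t\<^sup>2 - 1) / 2)" by simp
      with that have "t \<le> exp (- (t\<^sup>2 - 1) / 2)" by linarith
      then show ?thesis using std_normal_density_1_pos by (simp add: mult_le_0_iff)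
    qed
    show ?thesis
    proof (rule DERIV_nonpos_imp_nonincreasing[OF True])
      show "\<exists>y. (D has_real_derivative y) (at t) \<and> y \<le> 0" if "x \<le> t" "t \<le> 1" for t
        by (rule exI, rule conjI, rule D) ((rule *)?; use that assms in linarith)+
    qed
  next
    case False
    have *: "0 \<le> 2 * std_normal_density 1 * (t - exp (- (t\<^sup>2 - 1) / 2))" if "1 \<le> t" for t
    proof -
      have "1 \<le> t\<^sup>2" using that by simp
      then have "exp (- (t\<^sup>2 - 1) / 2) \<le> 1" by simp
      with that have "exp (- (t\<^sup>2 - 1) / 2) \<le> t" by linarith
      then show ?thesis using std_normal_density_1_pos by simp
    qed
    show ?thesis
    proof (rule DERIV_nonneg_imp_nondecreasing[of 1 x D])
      show "\<exists>y. (D has_real_derivative y) (at t) \<and> 0 \<le> y" if "1 \<le> t" for t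
        by (rule exI, rule conjI, rule D) ((rule *)?; use that in linarith)+
    qed (use False in simp)
  qed
  then show ?thesis by (simp add: D_def algebra_simps)
qed

text \<open>Jensen's inequality for \<open>exp\<close> on \<open>[1, 2]\<close>: the mean of \<open>(t\<^sup>2 - 1) / 2\<close> there is \<open>2 / 3\<close>,
  and \<open>exp (- 2 / 3) \<ge> 1 / 2\<close>.\<close>

lemma std_normal_central_2: "std_normal_central 1 + std_normal_density 1 \<le> std_normal_central 2"
proof -
  define c where "c = 2 * std_normal_density 1 * exp (- 2 / 3)"
  \<comment> \<open>Since \<open>exp (- (x\<^sup>2 - 1) / 2) = exp (- 2 / 3) * exp (7 / 6 -
    x\<^sup>2 / 2)\<close>, the bound \<open>1 + y \<le> exp y\<close> gives the minorant
    \<open>13 / 6 - x\<^sup>2 / 2\<close> of the second factor. The cubic is its antiderivative and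
    grows by exactly 1 from 1 to 2.\<close>
  define D where "D x = std_normal_central x - c * (13 / 6 * x - x ^ 3 / 6)" for x
  have D: "(D has_real_derivative
      2 * std_normal_density 1 * exp (- (x\<^sup>2 - 1) / 2) - c * (13 / 6 - x\<^sup>2 / 2)) (at x)"
    if "0 < x" for x
    unfolding D_def
    by (rule derivative_eq_intros DERIV_std_normal_central that refl | simp)+
      (simp add: algebra_simps power2_eq_square std_normal_density_eq_exp[of x])
  have *: "0 \<le> 2 * std_normal_density 1 * exp (- (x\<^sup>2 - 1) / 2) - c * (13 / 6 - x\<^sup>2 / 2)" for x
  proof -
    have "13 / 6 - x\<^sup>2 / 2 \<le> exp (7 / 6 - x\<^sup>2 / 2)"
      using exp_ge_add_one_self[of "7 / 6 - x\<^sup>2 / 2"] by simp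
    then have "c * (13 / 6 - x\<^sup>2 / 2) \<le> c * exp (7 / 6 - x\<^sup>2 / 2)"
      using std_normal_density_1_pos by (intro mult_left_mono) (auto simp: c_def)
    also have "\<dots> = 2 * std_normal_density 1 * exp (- (x\<^sup>2 - 1) / 2)"
      by (simp add: c_def field_simps flip: exp_add)
    finally show ?thesis by simp
  qed
  have "D 1 \<le> D 2"
  proof (rule DERIV_nonneg_imp_nondecreasing[of 1 2 D])
    show "\<exists>y. (D has_real_derivative y) (at t) \<and> 0 \<le> y" if "1 \<le> t" for t
      by (rule exI, rule conjI, rule D) ((rule *)?; use that in linarith)+
  qed simp
  then have "std_normal_central 1 + c \<le> std_normal_central 2" by (simp add: D_def)
  moreover have "exp (- ln 2) \<le> exp (- 2 / 3 :: real)" using ln2_ge_two_thirds by simp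
  then have "1 / 2 \<le> exp (- 2 / 3 :: real)" by (simp add: exp_minus)
  then have "std_normal_density 1 \<le> c"
    using std_normal_density_1_pos by (simp add: c_def)
  ultimately show ?thesis by simp
qed

text \<open>Applied to \<open>s = t\<^sup>2\<close> with \<open>1 < t\<close> and
  \<open>t \<le> 2\<close>, this compares the exponents in the lower tangent bound. Both cases rest
  on \<open>1 - 1 / y \<le> ln y\<close>: directly up to 2, and beyond 2 after splitting off
  \<open>ln 2 \<ge> 2 / 3\<close>.\<close>

lemma ln_gt_third:
  fixes s :: real
  assumes "1 < s" "s \<le> 4"
  shows "(s - 1) / 3 < ln s"
proof (cases "s \<le> 2")
  case True
  have "1 - 1 / s \<le> ln s" using ln_le_minus_one[of "1 / s"] assms by (simp add: ln_div)
  moreover have "(s - 1) / 3 < 1 - 1 / s"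
  proof -
    have "1 - 1 / s - (s - 1) / 3 = (s - 1) * (3 - s) / (3 * s)"
      using assms by (simp add: field_simps)
    also have "\<dots> > 0" using assms True by simp
    finally show ?thesis by simp
  qed
  ultimately show ?thesis by simp
next
  case False
  have "1 - 2 / s \<le> ln (s / 2)" using ln_le_minus_one[of "2 / s"] assms by (simp add: ln_div)
  then have "2 / 3 + (1 - 2 / s) \<le> ln s"
    using ln2_ge_two_thirds assms by (simp add: ln_div)
  moreover have "(s - 1) / 3 < 2 / 3 + (1 - 2 / s)"
  proof -
    have "2 / 3 + (1 - 2 / s) - (s - 1) / 3 = ((s - 2) * (4 - s) + 2) / (3 * s)"
      using assms by (simp add: field_simps)
    also have "\<dots> > 0" using assms False by (intro divide_pos_pos add_nonneg_pos) auto
    finally show ?thesis by simp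
  qed
  ultimately show ?thesis by simp
qed

text \<open>In the variable \<open>u = 1 / x\<^sup>2\<close> the left side is the tangent at
  \<open>u = 1\<close>. The function \<open>D\<close> decreases strictly up to 1 and increases
  strictly on \<open>[1, 2]\<close>. Far out its derivative turns negative again, so values beyond 2
  are compared with \<open>D 1\<close> directly.\<close>

lemma std_normal_central_gt_tangent:
  assumes "0 < x" "x \<noteq> 1"
  shows "std_normal_central 1 - std_normal_density 1 * (1 / x\<^sup>2 - 1) < std_normal_central x"
proof -
  define D where "D x = std_normal_central x + std_normal_density 1 / x\<^sup>2" for x
  have D: "(D has_real_derivative
      2 * std_normal_density 1 * (exp (- (t\<^sup>2 - 1) / 2) - 1 / t ^ 3)) (at t)"
    if "0 < t" for t
  proof -
    have "((\<lambda>x. std_normal_density 1 / x\<^sup>2) has_real_derivative - 2 * std_normal_density 1 / t ^ 3) (at t)"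
      using that by (auto intro!: derivative_eq_intros simp: field_simps eval_nat_numeral)
    from DERIV_add[OF DERIV_std_normal_central[OF that] this] show ?thesis
      unfolding D_def by (simp add: std_normal_density_eq_exp[of t] right_diff_distrib mult.assoc)
  qed
  \<comment> \<open>In exponential form the sign of the derivative is decided by comparing
    \<open>3 * ln (t\<^sup>2)\<close> with \<open>t\<^sup>2 - 1\<close>.\<close>
  have cube: "1 / t ^ 3 = exp (- 3 * ln (t\<^sup>2) / 2)" if "0 < t" for t :: real
  proof -
    have "exp (- 3 * ln (t\<^sup>2) / 2) = exp (- (3 * ln t))" using that by (simp add: ln_realpow)
    also have "\<dots> = 1 / exp (real 3 * ln t)" by (simp add: exp_minus field_simps)
    also have "\<dots> = 1 / t ^ 3" using that by (simp only: exp_of_nat_mult exp_ln)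
    finally show ?thesis by simp
  qed
  consider "x < 1" | "1 < x" "x \<le> 2" | "2 < x" using assms by linarith
  then have "D 1 < D x"
  proof cases
    case 1
    have *: "2 * std_normal_density 1 * (exp (- (t\<^sup>2 - 1) / 2) - 1 / t ^ 3) < 0"
      if "x < t" "t < 1" for t
    proof -
      have "t\<^sup>2 < 1" using that assms by (simp add: power_less_one_iff)
      \<comment> \<open>Here \<open>t\<^sup>2 - 1\<close> is negative, so tripling the logarithm
        makes the inequality strict.\<close>
      moreover have "ln (t\<^sup>2) \<le> t\<^sup>2 - 1" using that assms by (intro ln_le_minus_one) auto
      ultimately have "exp (- (t\<^sup>2 - 1) / 2) < 1 / t ^ 3"
        using that assms by (subst cube) auto
      then show ?thesis using std_normal_density_1_pos by (simp add: mult_less_0_iff)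
    qed
    show ?thesis
    proof (rule DERIV_neg_imp_decreasing_open[OF 1])
      show "continuous_on {x..1} D"
        by (intro continuous_at_imp_continuous_on ballI DERIV_isCont[OF D]) (use assms in auto)
      show "\<exists>y. (D has_real_derivative y) (at t) \<and> y < 0" if "x < t" "t < 1" for t
        by (rule exI, rule conjI, rule D) ((rule *)?; use that assms in linarith)+
    qed
  next
    case 2
    have *: "0 < 2 * std_normal_density 1 * (exp (- (t\<^sup>2 - 1) / 2) - 1 / t ^ 3)"
      if "1 < t" "t < x" for t
    proof -
      have "1 < t\<^sup>2" using that by simp
      moreover have "t\<^sup>2 \<le> 4" using that 2 power_mono[of t 2 2] by simp
      ultimately have "1 / t ^ 3 < exp (- (t\<^sup>2 - 1) / 2)"
        using that ln_gt_third[of "t\<^sup>2"] by (subst cube) auto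
      then show ?thesis using std_normal_density_1_pos by simp
    qed
    show ?thesis
    proof (rule DERIV_pos_imp_increasing_open[OF 2(1)])
      show "continuous_on {1..x} D"
        by (intro continuous_at_imp_continuous_on ballI DERIV_isCont[OF D]) auto
      show "\<exists>y. (D has_real_derivative y) (at t) \<and> 0 < y" if "1 < t" "t < x" for t
        by (rule exI, rule conjI, rule D) ((rule *)?; use that in linarith)+
    qed
  next
    case 3
    \<comment> \<open>Dropping the positive term of \<open>D x\<close> suffices here, because the
      central probability at 2 already reaches \<open>D 1\<close>.\<close>
    have "D 1 \<le> std_normal_central 2" using std_normal_central_2 by (simp add: D_def)
    also have "\<dots> \<le> std_normal_central x" using 3 by (intro std_normal_central_mono) simp
    also have "\<dots> < D x" using assms std_normal_density_1_pos by (simp add: D_def)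
    finally show ?thesis .
  qed
  then show ?thesis by (simp add: D_def algebra_simps)
qed

section \<open>Numerical value of the one-sigma probability\<close>

text \<open>The Lagrange remainders after five and six terms have the signs of
  \<open>(- u) ^ 5\<close> and \<open>(- u) ^ 6\<close>, so consecutive partial sums enclose the
  exponential.\<close>

lemma exp_minus_Taylor_bounds:
  fixes u :: real
  assumes "0 \<le> u"
  shows "exp (- u) \<le> 1 - u + u ^ 2 / 2 - u ^ 3 / 6 + u ^ 4 / 24"
    and "1 - u + u ^ 2 / 2 - u ^ 3 / 6 + u ^ 4 / 24 - u ^ 5 / 120 \<le> exp (- u)"
proof -
  obtain s where "exp (- u) = (\<Sum>m<5. (- u) ^ m / fact m) + exp s / fact 5 * (- u) ^ 5"
    using Maclaurin_exp_le[of "- u" 5] by blast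
  moreover have "0 \<le> exp s / fact 5 * u ^ 5" using assms by simp
  ultimately show "exp (- u) \<le> 1 - u + u ^ 2 / 2 - u ^ 3 / 6 + u ^ 4 / 24"
    by (simp add: eval_nat_numeral)
  obtain s where "exp (- u) = (\<Sum>m<6. (- u) ^ m / fact m) + exp s / fact 6 * (- u) ^ 6"
    using Maclaurin_exp_le[of "- u" 6] by blast
  moreover have "0 \<le> exp s / fact 6 * u ^ 6" using assms by simp
  ultimately show "1 - u + u ^ 2 / 2 - u ^ 3 / 6 + u ^ 4 / 24 - u ^ 5 / 120 \<le> exp (- u)"
    by (simp add: eval_nat_numeral)
qed

text \<open>The two constants delimit the numbers that round to 0.6827. The integrand is enclosed
  between Taylor polynomials in \<open>x\<^sup>2 / 2\<close>, which are integrated exactly.\<close>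

lemma std_normal_central_1_bounds: "0.68265 < std_normal_central 1" "std_normal_central 1 < 0.68275"
proof -
  define I where "I = integral {-1..1::real} (\<lambda>x. exp (- (x\<^sup>2 / 2)))"
  have I: "((\<lambda>x. exp (- (x\<^sup>2 / 2))) has_integral I) {-1..1::real}"
    unfolding I_def by (intro integrable_integral integrable_continuous_real continuous_intros) auto
  have eq: "std_normal_central 1 = I / sqrt (2 * pi)"
    unfolding std_normal_central_eq_integral std_normal_density_def I_def by simp
  \<comment> \<open>The parameter switches the last term: \<open>k = 0\<close> is the upper and
    \<open>k = 1\<close> the lower Taylor bound, so one antiderivative \<open>F\<close> serves
    both.\<close>
  define P where "P k u = 1 - u + u ^ 2 / 2 - u ^ 3 / 6 + u ^ 4 / 24 - k * u ^ 5 / 120" for k u :: real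
  have int_P: "((\<lambda>x. P k (x\<^sup>2 / 2)) has_integral
      2 * (1 - 1 / 6 + 1 / 40 - 1 / 336 + 1 / 3456 - k / 42240)) {-1..1::real}" for k
  proof -
    define F where "F x = x - x ^ 3 / 6 + x ^ 5 / 40 - x ^ 7 / 336 + x ^ 9 / 3456 - k * x ^ 11 / 42240"
      for x :: real
    have "((\<lambda>x. P k (x\<^sup>2 / 2)) has_integral F 1 - F (-1)) {-1..1}"
    proof (rule fundamental_theorem_of_calculus)
      show "(F has_vector_derivative P k (x\<^sup>2 / 2)) (at x within {-1..1})" for x
        unfolding F_def P_def has_real_derivative_iff_has_vector_derivative[symmetric]
        by (auto intro!: derivative_eq_intros simp: field_simps power_mult[symmetric])
    qed simp
    then show ?thesis by (simp add: F_def)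
  qed
  have "I \<le> 2 * (1 - 1 / 6 + 1 / 40 - 1 / 336 + 1 / 3456 - 0 / 42240)"
    by (rule has_integral_le[OF I int_P]) (use exp_minus_Taylor_bounds(1) in \<open>simp add: P_def\<close>)
  then have I_le: "I \<le> 1.7113" by simp
  have "2 * (1 - 1 / 6 + 1 / 40 - 1 / 336 + 1 / 3456 - 1 / 42240) \<le> I"
    by (rule has_integral_le[OF int_P I]) (use exp_minus_Taylor_bounds(2) in \<open>simp add: P_def\<close>)
  then have I_ge: "1.71124 \<le> I" by simp
  have "2.50662 \<le> sqrt (2 * pi)"
    using pi_approx by (intro real_le_rsqrt) (simp add: power2_eq_square)
  moreover have "sqrt (2 * pi) \<le> 2.50663"
    using pi_approx by (intro real_le_lsqrt) (auto simp: power2_eq_square)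
  ultimately show "0.68265 < std_normal_central 1" "std_normal_central 1 < 0.68275"
    using I_le I_ge by (simp_all add: eq field_simps)
qed

subsection \<open>The Gamma distribution\<close>

text \<open>The parameters are shape \<open>a\<close> and rate \<open>b\<close>, so the mean is
  \<open>a / b\<close>.\<close>

definition gamma_density :: "real \<Rightarrow> real \<Rightarrow> real \<Rightarrow> real" where
  "gamma_density a b w = (if w > 0 then b powr a / Gamma a * w powr (a - 1) * exp (- b * w) else 0)"

lemma borel_measurable_gamma_density [measurable]: "gamma_density a b \<in> borel_measurable borel"
  unfolding gamma_density_def[abs_def] by measurable

lemma gamma_density_nonneg: "0 < a \<Longrightarrow> 0 \<le> gamma_density a b w"
  by (simp add: gamma_density_def)

lemma Gamma_real_plus1: "0 < a \<Longrightarrow> Gamma (a + 1) = a * Gamma (a :: real)"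
  by (intro Gamma_plus1) (auto elim!: nonpos_Ints_cases)

text \<open>Euler's integral for \<open>Gamma s\<close> after the substitution
  \<open>t = b * w\<close>.\<close>

lemma nn_integral_gamma_kernel:
  fixes s b :: real
  assumes "0 < s" "0 < b"
  shows "(\<integral>\<^sup>+w. ennreal (if w > 0 then w powr (s - 1) * exp (- b * w) else 0) \<partial>lborel)
    = ennreal (Gamma s / b powr s)"
proof -
  have "ennreal (Gamma s) = (\<integral>\<^sup>+t. ennreal (indicator {0..} t * t powr (s - 1) / exp t) \<partial>lborel)"
    using Gamma_conv_nn_integral_real[OF assms(1)] .
  also have "\<dots> = ennreal b * (\<integral>\<^sup>+w. ennreal (indicator {0..} (b * w) * (b * w) powr (s - 1) / exp (b * w)) \<partial>lborel)"
    using assms by (subst nn_integral_real_affine[where c = b and t = 0]) auto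
  also have "\<dots> = (\<integral>\<^sup>+w. ennreal (b powr s) * ennreal (if w > 0 then w powr (s - 1) * exp (- b * w) else 0) \<partial>lborel)"
  proof (subst nn_integral_cmult[symmetric], simp, intro nn_integral_cong)
    fix w :: real
    have "b * (b * w) powr (s - 1) = b powr s * w powr (s - 1)" if "0 < w"
      using assms that by (simp add: powr_mult powr_diff)
    then show "ennreal b * ennreal (indicator {0..} (b * w) * (b * w) powr (s - 1) / exp (b * w))
        = ennreal (b powr s) * ennreal (if w > 0 then w powr (s - 1) * exp (- b * w) else 0)"
      using assms by (cases "w = 0")
        (auto simp: indicator_def zero_le_mult_iff exp_minus divide_inverse mult.assoc simp flip: ennreal_mult)
  qed
  also have "\<dots> = ennreal (b powr s) * (\<integral>\<^sup>+w. ennreal (if w > 0 then w powr (s - 1) * exp (- b * w) else 0) \<partial>lborel)"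
    by (intro nn_integral_cmult) measurable
  finally have *: "ennreal (Gamma s) = \<dots>" .
  have "ennreal (Gamma s / b powr s) = ennreal (Gamma s) * ennreal (1 / b powr s)"
    using assms by (simp flip: ennreal_mult)
  also have "\<dots> = ennreal (b powr s) * ennreal (1 / b powr s) *
      (\<integral>\<^sup>+w. ennreal (if w > 0 then w powr (s - 1) * exp (- b * w) else 0) \<partial>lborel)"
    by (subst *) (simp add: ac_simps)
  also have "ennreal (b powr s) * ennreal (1 / b powr s) = 1"
    using assms by (simp flip: ennreal_mult)
  finally show ?thesis by simp
qed

text \<open>Multiplying by \<open>w powr p\<close> gives a Gamma kernel of shape
  \<open>a + p\<close> with the same rate. The exponents 0, 1 and -1 will yield the total mass, the
  mean and the inverse moment.\<close>

lemma nn_integral_powr_gamma_density: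
  assumes "0 < a" "0 < b" "0 < a + p"
  shows "(\<integral>\<^sup>+w. ennreal (w powr p) * ennreal (gamma_density a b w) \<partial>lborel)
    = ennreal (Gamma (a + p) / (Gamma a * b powr p))"
proof -
  have "(\<integral>\<^sup>+w. ennreal (w powr p) * ennreal (gamma_density a b w) \<partial>lborel)
      = (\<integral>\<^sup>+w. ennreal (b powr a / Gamma a) *
          ennreal (if w > 0 then w powr (a + p - 1) * exp (- b * w) else 0) \<partial>lborel)"
    using assms
    by (intro nn_integral_cong)
      (auto simp: gamma_density_def powr_add[symmetric] algebra_simps simp flip: ennreal_mult)
  also have "\<dots> = ennreal (b powr a / Gamma a) * ennreal (Gamma (a + p) / b powr (a + p))"
    using assms by (subst nn_integral_cmult) (simp_all add: nn_integral_gamma_kernel)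
  also have "\<dots> = ennreal (Gamma (a + p) / (Gamma a * b powr p))"
    using assms by (simp add: powr_add flip: ennreal_mult)
  finally show ?thesis .
qed

lemma prob_space_gamma_density:
  assumes "0 < a" "0 < b"
  shows "prob_space (density lborel (gamma_density a b))"
proof
  have "(\<integral>\<^sup>+w. ennreal (gamma_density a b w) \<partial>lborel)
      = (\<integral>\<^sup>+w. ennreal (w powr 0) * ennreal (gamma_density a b w) \<partial>lborel)"
    by (intro nn_integral_cong) (auto simp: gamma_density_def)
  then show "emeasure (density lborel (gamma_density a b)) (space (density lborel (gamma_density a b))) = 1"
    using assms nn_integral_powr_gamma_density[of a b 0] Gamma_real_pos[OF assms(1)]
    by (simp add: emeasure_density del: Gamma_real_pos)
qed

text \<open>The excluded point \<open>c\<close> will be the tangency point 1, the one positive point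
  where the lower tangent bound is not strict.\<close>

lemma AE_gamma_density:
  "AE w in density lborel (gamma_density a b). 0 < w \<and> w \<noteq> c"
proof -
  have "AE w in lborel. w \<noteq> c" by (rule AE_lborel_singleton)
  then show ?thesis
    by (subst AE_density) (auto elim!: eventually_mono simp: gamma_density_def split: if_splits)
qed

lemma AE_gamma_density_pos: "AE w in density lborel (gamma_density a b). 0 < w"
  using AE_gamma_density[where c = 0] by (rule eventually_mono) simp

lemma has_bochner_integral_gamma_density_powr:
  assumes "0 < a" "0 < b" "0 < a + p"
  shows "has_bochner_integral (density lborel (gamma_density a b)) (\<lambda>w. w powr p)
    (Gamma (a + p) / (Gamma a * b powr p))"
  using assms Gamma_real_pos[of a] Gamma_real_pos[of "a + p"]
  by (intro has_bochner_integral_nn_integral)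
    (auto simp: nn_integral_density nn_integral_powr_gamma_density mult.commute intro!: divide_nonneg_nonneg)

lemma integral_gamma_density:
  assumes "0 < a" "0 < b"
  shows "integrable (density lborel (gamma_density a b)) (\<lambda>w. w)"
    and "(\<integral>w. w \<partial>density lborel (gamma_density a b)) = a / b"
proof -
  have "Gamma (a + 1) / (Gamma a * b powr 1) = a / b"
    using assms Gamma_real_pos[OF assms(1)] by (simp add: Gamma_real_plus1 del: Gamma_real_pos)
  moreover have "has_bochner_integral (density lborel (gamma_density a b)) (\<lambda>w. w powr 1)
      (Gamma (a + 1) / (Gamma a * b powr 1))"
    using assms by (intro has_bochner_integral_gamma_density_powr) auto
  ultimately have "has_bochner_integral (density lborel (gamma_density a b)) (\<lambda>w. w powr 1) (a / b)"
    by (simp only:)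
  then have "has_bochner_integral (density lborel (gamma_density a b)) (\<lambda>w. w) (a / b)"
    by (rule has_bochner_integral_cong_AE[THEN iffD1, rotated 3])
      (auto intro!: eventually_mono[OF AE_gamma_density_pos])
  then show "integrable (density lborel (gamma_density a b)) (\<lambda>w. w)"
    and "(\<integral>w. w \<partial>density lborel (gamma_density a b)) = a / b"
    by (auto simp: has_bochner_integral_iff)
qed

lemma has_bochner_integral_inverse_gamma_density:
  assumes "1 < a" "0 < b"
  shows "has_bochner_integral (density lborel (gamma_density a b)) (\<lambda>w. 1 / w) (b / (a - 1))"
proof -
  have G: "Gamma a = (a - 1) * Gamma (a - 1)"
    using Gamma_real_plus1[of "a - 1"] assms by simp
  have "Gamma (a - 1) \<noteq> 0"
    by (rule less_imp_neq[OF Gamma_real_pos, symmetric]) (use assms in simp)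
  then have "Gamma (a + - 1) / (Gamma a * b powr - 1) = b / (a - 1)"
    using assms by (simp add: G powr_minus divide_simps)
  moreover have "has_bochner_integral (density lborel (gamma_density a b)) (\<lambda>w. w powr - 1)
      (Gamma (a + - 1) / (Gamma a * b powr - 1))"
    using assms by (intro has_bochner_integral_gamma_density_powr) auto
  ultimately have "has_bochner_integral (density lborel (gamma_density a b)) (\<lambda>w. w powr - 1) (b / (a - 1))"
    by (simp only:)
  then show ?thesis
    by (rule has_bochner_integral_cong_AE[THEN iffD1, rotated 3])
      (auto intro!: eventually_mono[OF AE_gamma_density_pos] simp: powr_minus divide_inverse)
qed

subsection \<open>The t distribution as a normal scale mixture\<close>

context
  fixes \<nu> \<sigma> :: real
  assumes \<nu>: "2 < \<nu>" and \<sigma>: "0 < \<sigma>" "\<sigma>\<^sup>2 = \<nu> / (\<nu> - 2)"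
begin

text \<open>For fixed \<open>x\<close> the product of the normal and Gamma densities is, as a
  function of \<open>w\<close>, a multiple of a Gamma kernel of shape \<open>a + 1 / 2\<close> and
  rate \<open>r\<close>. Its total mass produces the power of
  \<open>1 + x\<^sup>2 / \<nu>\<close>.\<close>

lemma student_t_density_mixture:
  "ennreal (student_t_density \<nu> x) =
    (\<integral>\<^sup>+w. ennreal (normal_density 0 (\<sigma> / sqrt w) x) * ennreal (gamma_density (\<nu> / 2) (\<nu> / 2 - 1) w) \<partial>lborel)"
proof -
  define a b where "a = \<nu> / 2" and "b = \<nu> / 2 - 1"
  define r where "r = b * (1 + x\<^sup>2 / \<nu>)"
  define C where "C = b powr a / (Gamma a * \<sigma> * sqrt (2 * pi))"
  have ab: "0 < a" "0 < b" "0 < r" using \<nu> by (auto simp: a_def b_def r_def intro!: mult_pos_pos add_pos_nonneg)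
  have C: "0 \<le> C" using ab \<sigma> by (simp add: C_def)
  \<comment> \<open>The Gamma rate \<open>b\<close> and the coefficient of \<open>w\<close> in the
    normal exponent add up to \<open>r\<close>; this uses the value of
    \<open>\<sigma>\<^sup>2\<close>.\<close>
  have r: "r = b + x\<^sup>2 / (2 * \<sigma>\<^sup>2)"
    using \<nu> unfolding \<sigma> by (simp add: r_def b_def field_simps)
  have "(\<integral>\<^sup>+w. ennreal (normal_density 0 (\<sigma> / sqrt w) x) * ennreal (gamma_density a b w) \<partial>lborel)
    = (\<integral>\<^sup>+w. ennreal C * ennreal (if w > 0 then w powr ((a + 1 / 2) - 1) * exp (- r * w) else 0) \<partial>lborel)"
  proof (intro nn_integral_cong)
    fix w :: real
    have "normal_density 0 (\<sigma> / sqrt w) x * gamma_density a b w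
        = C * (w powr ((a + 1 / 2) - 1) * exp (- r * w))" if "0 < w"
    proof -
      have "w powr ((a + 1 / 2) - 1) = sqrt w * w powr (a - 1)"
        using that by (simp add: powr_half_sqrt[symmetric] powr_add[symmetric] add.commute diff_add_eq)
      moreover have "exp (- r * w) = exp (- x\<^sup>2 / (2 * (\<sigma> / sqrt w)\<^sup>2)) * exp (- b * w)"
        using that \<sigma>(1) by (simp add: r field_simps flip: exp_add)
      moreover have "1 / sqrt (2 * pi * (\<sigma> / sqrt w)\<^sup>2) = sqrt w / (\<sigma> * sqrt (2 * pi))"
        using that \<sigma>(1) by (simp add: real_sqrt_mult real_sqrt_divide field_simps)
      ultimately show ?thesis
        using that by (simp add: normal_density_def gamma_density_def C_def ac_simps)
    qed
    then show "ennreal (normal_density 0 (\<sigma> / sqrt w) x) * ennreal (gamma_density a b w)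
      = ennreal C * ennreal (if w > 0 then w powr ((a + 1 / 2) - 1) * exp (- r * w) else 0)"
      using C ab by (auto simp: gamma_density_nonneg gamma_density_def simp flip: ennreal_mult)
  qed
  also have "\<dots> = ennreal C * ennreal (Gamma (a + 1 / 2) / r powr (a + 1 / 2))"
    using ab by (subst nn_integral_cmult) (simp_all add: nn_integral_gamma_kernel)
  also have "\<dots> = ennreal (C * (Gamma (a + 1 / 2) / r powr (a + 1 / 2)))"
    using C ab by (intro ennreal_mult[symmetric] divide_nonneg_nonneg) auto
  also have "C * (Gamma (a + 1 / 2) / r powr (a + 1 / 2)) = student_t_density \<nu> x"
  proof -
    have "r powr (a + 1 / 2) = b powr a * sqrt b * (1 + x\<^sup>2 / \<nu>) powr (a + 1 / 2)"
      using ab \<nu> by (simp add: r_def powr_mult powr_add powr_half_sqrt)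
    moreover have "\<sigma> * sqrt (2 * pi) * sqrt b = sqrt (\<nu> * pi)"
    proof -
      have "\<sigma> = sqrt (\<nu> / (\<nu> - 2))" using \<sigma> by (metis real_sqrt_abs abs_of_pos)
      then show ?thesis using \<nu> by (simp add: b_def field_simps flip: real_sqrt_mult)
    qed
    moreover have "student_t_density \<nu> x = Gamma (a + 1 / 2) / (sqrt (\<nu> * pi) * Gamma a) / (1 + x\<^sup>2 / \<nu>) powr (a + 1 / 2)"
    proof -
      have "(\<nu> + 1) / 2 = a + 1 / 2" "\<nu> / 2 = a"
        by (simp_all add: a_def add_divide_distrib)
      then show ?thesis
        unfolding student_t_density_def by (simp only: powr_minus_divide times_divide_eq_right mult_1_right)
    qed
    ultimately show ?thesis
      using ab by (simp add: C_def mult_ac)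
  qed
  finally show ?thesis by (simp add: a_def b_def)
qed

text \<open>Tonelli's theorem carries the mixture over to nonnegative test functions; squares and
  the indicator of \<open>{-\<sigma>..\<sigma>}\<close> are the two needed.\<close>

lemma nn_integral_student_t_density:
  assumes [measurable]: "h \<in> borel_measurable borel"
  shows "(\<integral>\<^sup>+x. ennreal (student_t_density \<nu> x) * h x \<partial>lborel) =
    (\<integral>\<^sup>+w. (\<integral>\<^sup>+x. ennreal (normal_density 0 (\<sigma> / sqrt w) x) * h x \<partial>lborel)
      \<partial>density lborel (gamma_density (\<nu> / 2) (\<nu> / 2 - 1)))"
proof -
  let ?n = "\<lambda>w x. ennreal (normal_density 0 (\<sigma> / sqrt w) x)"
  let ?g = "\<lambda>w. ennreal (gamma_density (\<nu> / 2) (\<nu> / 2 - 1) w)"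
  have [measurable]: "(\<lambda>(w, x). normal_density 0 (\<sigma> / sqrt w) x) \<in> borel_measurable (borel \<Otimes>\<^sub>M borel)"
    unfolding normal_density_def by measurable
  have "(\<integral>\<^sup>+x. ennreal (student_t_density \<nu> x) * h x \<partial>lborel)
      = (\<integral>\<^sup>+x. (\<integral>\<^sup>+w. ?n w x * ?g w * h x \<partial>lborel) \<partial>lborel)"
    unfolding student_t_density_mixture by (intro nn_integral_cong nn_integral_multc[symmetric]) measurable
  also have "\<dots> = (\<integral>\<^sup>+w. (\<integral>\<^sup>+x. ?n w x * ?g w * h x \<partial>lborel) \<partial>lborel)"
    by (rule lborel_pair.Fubini') measurable
  also have "\<dots> = (\<integral>\<^sup>+w. ?g w * (\<integral>\<^sup>+x. ?n w x * h x \<partial>lborel) \<partial>lborel)"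
    by (subst nn_integral_cmult[symmetric]) (auto simp: ac_simps)
  also have "\<dots> = (\<integral>\<^sup>+w. (\<integral>\<^sup>+x. ?n w x * h x \<partial>lborel) \<partial>density lborel ?g)"
    by (subst nn_integral_density) auto
  finally show ?thesis .
qed

text \<open>Given \<open>w\<close> the second moment is \<open>\<sigma>\<^sup>2 / w\<close>, and the
  rate \<open>\<nu> / 2 - 1\<close> is the one for which \<open>1 / w\<close> has mean 1.\<close>

lemma nn_integral_student_t_density_square:
  "(\<integral>\<^sup>+x. ennreal (student_t_density \<nu> x) * ennreal (x\<^sup>2) \<partial>lborel) = ennreal (\<nu> / (\<nu> - 2))"
proof -
  let ?Q = "density lborel (gamma_density (\<nu> / 2) (\<nu> / 2 - 1))"
  have inner: "(\<integral>\<^sup>+x. ennreal (normal_density 0 s x) * ennreal (x\<^sup>2) \<partial>lborel) = ennreal (s\<^sup>2)"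
    if "0 < s" for s
  proof -
    have "has_bochner_integral lborel (\<lambda>x. normal_density 0 s x * x\<^sup>2) (s\<^sup>2)"
      using normal_moment_even[OF that, of 0 1] that by (simp add: fact_numeral)
    then show ?thesis
      by (subst ennreal_mult[symmetric]) (auto simp: has_bochner_integral_iff nn_integral_eq_integral)
  qed
  have hb: "has_bochner_integral ?Q (\<lambda>w. 1 / w) 1"
    using has_bochner_integral_inverse_gamma_density[of "\<nu> / 2" "\<nu> / 2 - 1"] \<nu> by simp
  have "(\<integral>\<^sup>+x. ennreal (student_t_density \<nu> x) * ennreal (x\<^sup>2) \<partial>lborel)
      = (\<integral>\<^sup>+w. (\<integral>\<^sup>+x. ennreal (normal_density 0 (\<sigma> / sqrt w) x) * ennreal (x\<^sup>2) \<partial>lborel) \<partial>?Q)"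
    by (rule nn_integral_student_t_density) simp
  also have "\<dots> = (\<integral>\<^sup>+w. ennreal (\<sigma>\<^sup>2) * ennreal (1 / w) \<partial>?Q)"
    using \<sigma>(1)
    by (intro nn_integral_cong_AE eventually_mono[OF AE_gamma_density_pos]) (simp_all add: inner divide_inverse power_mult_distrib power_inverse ennreal_mult)
  also have "\<dots> = ennreal (\<sigma>\<^sup>2) * (\<integral>\<^sup>+w. ennreal (1 / w) \<partial>?Q)"
    by (rule nn_integral_cmult) measurable
  also have "(\<integral>\<^sup>+w. ennreal (1 / w) \<partial>?Q) = ennreal 1"
    using hb
    by (subst nn_integral_eq_integral)
      (auto simp: has_bochner_integral_iff intro!: eventually_mono[OF AE_gamma_density_pos])
  finally show ?thesis by (simp add: \<sigma>)
qed

text \<open>Given \<open>w\<close>, dividing by the conditional standard deviation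
  \<open>\<sigma> / sqrt w\<close> turns \<open>{-\<sigma>..\<sigma>}\<close> into the interval with
  end points \<open>- sqrt w\<close> and \<open>sqrt w\<close>.\<close>

lemma nn_integral_student_t_density_central:
  "(\<integral>\<^sup>+x. ennreal (student_t_density \<nu> x) * indicator {-\<sigma>..\<sigma>} x \<partial>lborel) =
    ennreal (\<integral>w. std_normal_central (sqrt w) \<partial>density lborel (gamma_density (\<nu> / 2) (\<nu> / 2 - 1)))"
proof -
  let ?Q = "density lborel (gamma_density (\<nu> / 2) (\<nu> / 2 - 1))"
  interpret Q: prob_space ?Q using \<nu> by (intro prob_space_gamma_density) auto
  have inner: "(\<integral>\<^sup>+x. ennreal (normal_density 0 (\<sigma> / r) x) * indicator {-\<sigma>..\<sigma>} x \<partial>lborel)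
      = ennreal (std_normal_central r)" if "0 < r" for r
  proof -
    have "(\<integral>\<^sup>+x. ennreal (normal_density 0 (\<sigma> / r) x) * indicator {-\<sigma>..\<sigma>} x \<partial>lborel)
      = ennreal (\<sigma> / r) *
        (\<integral>\<^sup>+y. ennreal (normal_density 0 (\<sigma> / r) (\<sigma> / r * y)) * indicator {-\<sigma>..\<sigma>} (\<sigma> / r * y) \<partial>lborel)"
      using that \<sigma>(1) by (subst nn_integral_real_affine[where c = "\<sigma> / r" and t = 0]) auto
    also have "\<dots> = (\<integral>\<^sup>+y. ennreal (std_normal_density y) * indicator {-r..r} y \<partial>lborel)"
    proof (subst nn_integral_cmult[symmetric], measurable, intro nn_integral_cong)
      fix y :: real
      have "\<sigma> / r * normal_density 0 (\<sigma> / r) (\<sigma> / r * y) = std_normal_density y"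
        using that \<sigma>(1)
        by (simp add: normal_density_def power_mult_distrib power_divide real_sqrt_mult real_sqrt_divide)
      moreover have "\<sigma> / r * y \<in> {-\<sigma>..\<sigma>} \<longleftrightarrow> y \<in> {-r..r}"
        using that \<sigma>(1) mult_le_cancel_left_pos[OF \<sigma>(1), of "- r" y]
        by (auto simp: field_simps)
      ultimately show "ennreal (\<sigma> / r) * (ennreal (normal_density 0 (\<sigma> / r) (\<sigma> / r * y)) * indicator {-\<sigma>..\<sigma>} (\<sigma> / r * y))
          = ennreal (std_normal_density y) * indicator {-r..r} y"
        using that \<sigma>(1) by (auto simp: indicator_def simp flip: ennreal_mult)
    qed
    also have "\<dots> = ennreal (std_normal_central r)"
      by (simp add: emeasure_density flip: emeasure_std_normal_central)
    finally show ?thesis .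
  qed
  have "(\<integral>\<^sup>+x. ennreal (student_t_density \<nu> x) * indicator {-\<sigma>..\<sigma>} x \<partial>lborel)
      = (\<integral>\<^sup>+w. (\<integral>\<^sup>+x. ennreal (normal_density 0 (\<sigma> / sqrt w) x) * indicator {-\<sigma>..\<sigma>} x \<partial>lborel) \<partial>?Q)"
    by (rule nn_integral_student_t_density) simp
  also have "\<dots> = (\<integral>\<^sup>+w. ennreal (std_normal_central (sqrt w)) \<partial>?Q)"
    by (intro nn_integral_cong_AE eventually_mono[OF AE_gamma_density_pos]) (simp add: inner)
  also have "\<dots> = ennreal (\<integral>w. std_normal_central (sqrt w) \<partial>?Q)"
    by (intro nn_integral_eq_integral Q.integrable_const_bound[where B = 1])
      (auto simp: std_normal_central_nonneg std_normal_central_le_1)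
  finally show ?thesis .
qed

end

section \<open>Jensen bounds for normal scale mixtures\<close>

text \<open>Integrate the lower tangent bound in \<open>1 / w\<close>. Its linear term vanishes
  because \<open>1 / w\<close> has mean 1, and strictness survives because the bound is strict
  almost everywhere on a space of mass 1.\<close>

lemma normal_scale_mixture_gt:
  fixes M :: "real measure"
  assumes M: "prob_space M"
    and int: "has_bochner_integral M (\<lambda>w. 1 / w) (1 :: real)"
    and ae: "AE w in M. 0 < w \<and> w \<noteq> 1"
    and sets: "sets M = sets borel"
  shows "std_normal_central 1 < (\<integral>w. std_normal_central (sqrt w) \<partial>M)"
proof -
  interpret prob_space M by (rule M)
  have [measurable]: "(\<lambda>w. std_normal_central (sqrt w)) \<in> borel_measurable M"
    using sets by (simp cong: measurable_cong_sets)
  have I: "integrable M (\<lambda>w. 1 / w)" "(\<integral>w. 1 / w \<partial>M) = 1"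
    using int by (auto simp: has_bochner_integral_iff)
  have "std_normal_central 1 =
      (\<integral>w. std_normal_central 1 - std_normal_density 1 * (1 / w - 1) \<partial>M)"
    using I by (simp add: prob_space del: divide_const_simps)
  also have "\<dots> < (\<integral>w. std_normal_central (sqrt w) \<partial>M)"
  proof (rule integral_less_AE_space)
    show "integrable M (\<lambda>w. std_normal_central (sqrt w))"
      by (rule integrable_const_bound[where B = 1])
        (auto simp: std_normal_central_nonneg std_normal_central_le_1)
    show "AE w in M. std_normal_central 1 - std_normal_density 1 * (1 / w - 1) < std_normal_central (sqrt w)"
      using ae
    proof eventually_elim
      case (elim w)
      then show ?case using std_normal_central_gt_tangent[of "sqrt w"] by simp
    qed
  qed (use I in \<open>auto simp: emeasure_space_1\<close>)
  finally show ?thesis .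
qed

text \<open>Integrate the upper tangent bound, which is linear in \<open>w\<close> itself, so only
  the mean of \<open>w\<close> enters.\<close>

lemma normal_scale_mixture_le:
  fixes M :: "real measure"
  assumes M: "prob_space M"
    and int: "integrable M (\<lambda>w. w :: real)"
    and ae: "AE w in M. 0 < w"
    and sets: "sets M = sets borel"
  shows "(\<integral>w. std_normal_central (sqrt w) \<partial>M)
    \<le> std_normal_central 1 + std_normal_density 1 * ((\<integral>w. w \<partial>M) - 1)"
proof -
  interpret prob_space M by (rule M)
  have [measurable]: "(\<lambda>w. std_normal_central (sqrt w)) \<in> borel_measurable M"
    using sets by (simp cong: measurable_cong_sets)
  have "(\<integral>w. std_normal_central (sqrt w) \<partial>M)
      \<le> (\<integral>w. std_normal_central 1 + std_normal_density 1 * (w - 1) \<partial>M)"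
  proof (rule integral_mono_AE)
    show "integrable M (\<lambda>w. std_normal_central (sqrt w))"
      by (rule integrable_const_bound[where B = 1])
        (auto simp: std_normal_central_nonneg std_normal_central_le_1)
    show "AE w in M. std_normal_central (sqrt w) \<le> std_normal_central 1 + std_normal_density 1 * (w - 1)"
      using ae
    proof eventually_elim
      case (elim w)
      then show ?case using std_normal_central_le_tangent[of "sqrt w"] by simp
    qed
  qed (use int in auto)
  also have "\<dots> = std_normal_central 1 + std_normal_density 1 * ((\<integral>w. w \<partial>M) - 1)"
    using int by (simp add: prob_space)
  finally show ?thesis .
qed

section \<open>Application to the t distribution and the infimum\<close>

text \<open>The mean is 0 and the variance \<open>\<sigma>\<^sup>2\<close>, so the event says that
  \<open>X\<close> lies in \<open>{-\<sigma>..\<sigma>}\<close>. Its probability is the Gamma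
  mixture bounded by the two preceding lemmas; the excess in the upper bound comes from the mean of
  \<open>w\<close>.\<close>

lemma (in prob_space) student_t_central_prob_bounds:
  assumes X: "distributed M lborel X (\<lambda>x. ennreal (student_t_density \<nu> x))" and \<nu>: "2 < \<nu>"
  defines "P \<equiv> \<P>(\<omega> in M. \<bar>X \<omega> - expectation X\<bar> \<le> sqrt (variance X))"
  shows "std_normal_central 1 < P"
    and "P \<le> std_normal_central 1 + 2 * std_normal_density 1 / (\<nu> - 2)"
proof -
  define \<sigma> where "\<sigma> = sqrt (\<nu> / (\<nu> - 2))"
  have \<sigma>: "0 < \<sigma>" "\<sigma>\<^sup>2 = \<nu> / (\<nu> - 2)" using \<nu> by (auto simp: \<sigma>_def)
  let ?Q = "density lborel (gamma_density (\<nu> / 2) (\<nu> / 2 - 1))"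
  interpret Q: prob_space ?Q using \<nu> by (intro prob_space_gamma_density) auto
  have nonneg: "0 \<le> student_t_density \<nu> x" for x
    using \<nu> by (simp add: student_t_density_def)
  have X_meas [measurable]: "X \<in> borel_measurable M"
    using distributed_measurable[OF X] by simp
  have "expectation X = (\<integral>x. student_t_density \<nu> x * x \<partial>lborel)"
    using distributed_integral[OF X, of "\<lambda>x. x"] nonneg by simp
  also have "\<dots> = 0"
  proof -
    let ?I = "\<integral>x. student_t_density \<nu> x * x \<partial>lborel"
    \<comment> \<open>The density is even, so reflection turns the integral into its own
      negative.\<close>
    have "?I = (\<integral>x. student_t_density \<nu> (- x) * (- x) \<partial>lborel)"
      using lborel_integral_real_affine[of "-1" "\<lambda>x. student_t_density \<nu> x * x" 0] by simp
    also have "\<dots> = - ?I" by (simp add: student_t_density_def)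
    finally show ?thesis by simp
  qed
  finally have mean: "expectation X = 0" .
  have "(\<integral>\<^sup>+\<omega>. ennreal ((X \<omega>)\<^sup>2) \<partial>M) = ennreal (\<nu> / (\<nu> - 2))"
    using distributed_nn_integral[OF X, of "\<lambda>x. ennreal (x\<^sup>2)"]
      nn_integral_student_t_density_square[OF \<nu> \<sigma>] by simp
  then have "expectation (\<lambda>\<omega>. (X \<omega>)\<^sup>2) = \<nu> / (\<nu> - 2)"
    using \<nu> by (subst integral_eq_nn_integral) auto
  then have "P = prob (X -` {-\<sigma>..\<sigma>} \<inter> space M)"
    unfolding P_def mean by (auto simp: \<sigma>_def abs_le_iff intro!: arg_cong[where f = prob])
  moreover have "emeasure M (X -` {-\<sigma>..\<sigma>} \<inter> space M) = ennreal (\<integral>w. std_normal_central (sqrt w) \<partial>?Q)"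
    using distributed_emeasure[OF X, of "{-\<sigma>..\<sigma>}"]
      nn_integral_student_t_density_central[OF \<nu> \<sigma>] by simp
  ultimately have P: "P = (\<integral>w. std_normal_central (sqrt w) \<partial>?Q)"
    by (simp add: measure_def integral_nonneg_AE std_normal_central_nonneg)
  show "std_normal_central 1 < P"
    unfolding P
  proof (rule normal_scale_mixture_gt)
    show "has_bochner_integral ?Q (\<lambda>w. 1 / w) 1"
      using has_bochner_integral_inverse_gamma_density[of "\<nu> / 2" "\<nu> / 2 - 1"] \<nu> by simp
  qed (rule Q.prob_space_axioms AE_gamma_density | simp)+
  have "P \<le> std_normal_central 1 + std_normal_density 1 * ((\<integral>w. w \<partial>?Q) - 1)"
    unfolding P
    by (rule normal_scale_mixture_le)
      (use \<nu> in \<open>auto intro: integral_gamma_density AE_gamma_density_pos Q.prob_space_axioms\<close>)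
  also have "(\<integral>w. w \<partial>?Q) - 1 = 2 / (\<nu> - 2)"
    using \<nu> by (subst integral_gamma_density) (auto simp: field_simps)
  finally show "P \<le> std_normal_central 1 + 2 * std_normal_density 1 / (\<nu> - 2)"
    by (simp add: ac_simps)
qed

theorem theorem5p1:
  fixes M :: "nat \<Rightarrow> 'a measure" and X :: "nat \<Rightarrow> 'a \<Rightarrow> real"
    and N :: "'b measure" and Z :: "'b \<Rightarrow> real"
  assumes prob_M: "\<And>\<nu>. \<nu> \<ge> 3 \<Longrightarrow> prob_space (M \<nu>)"
    and X_student_t: "\<And>\<nu>. \<nu> \<ge> 3 \<Longrightarrow>
      distributed (M \<nu>) lborel (X \<nu>) (\<lambda>x. ennreal (student_t_density (real \<nu>) x))"
    and prob_N: "prob_space N"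
    and Z_normal: "distributed N lborel Z (\<lambda>x. ennreal (std_normal_density x))"
  shows "(\<forall>\<nu>\<ge>3.
            \<P>(\<omega> in M \<nu>. \<bar>X \<nu> \<omega> - prob_space.expectation (M \<nu>) (X \<nu>)\<bar>
                        \<le> sqrt (prob_space.variance (M \<nu>) (X \<nu>)))
            > \<P>(\<omega> in N. \<bar>Z \<omega>\<bar> \<le> 1))
       \<and> round_decimals 4 (\<P>(\<omega> in N. \<bar>Z \<omega>\<bar> \<le> 1)) = 0.6827
       \<and> (INF \<nu>\<in>{3..}.
            \<P>(\<omega> in M \<nu>. \<bar>X \<nu> \<omega> - prob_space.expectation (M \<nu>) (X \<nu>)\<bar>
                        \<le> sqrt (prob_space.variance (M \<nu>) (X \<nu>))))
          = \<P>(\<omega> in N. \<bar>Z \<omega>\<bar> \<le> 1)"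
proof -
  define A where "A = \<P>(\<omega> in N. \<bar>Z \<omega>\<bar> \<le> 1)"
  define P where "P \<nu> = \<P>(\<omega> in M \<nu>. \<bar>X \<nu> \<omega> - prob_space.expectation (M \<nu>) (X \<nu>)\<bar>
    \<le> sqrt (prob_space.variance (M \<nu>) (X \<nu>)))" for \<nu>
  have "{\<omega> \<in> space N. \<bar>Z \<omega>\<bar> \<le> 1} = Z -` {-1..1} \<inter> space N"
    by (auto simp: abs_le_iff)
  then have A: "A = std_normal_central 1"
    using distributed_emeasure[OF Z_normal, of "{-1..1}"]
    by (simp add: A_def std_normal_central_def measure_def emeasure_density)
  have lower: "A < P \<nu>" and upper: "P \<nu> \<le> A + 2 * std_normal_density 1 / (real \<nu> - 2)"
    if "3 \<le> \<nu>" for \<nu>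
    using prob_space.student_t_central_prob_bounds[OF prob_M X_student_t, OF that that] that
    by (auto simp: A P_def)
  \<comment> \<open>After scaling, the numerical bounds are 6826.5 and 6827.5.\<close>
  have "round (A * 10 ^ 4) = 6827"
    using std_normal_central_1_bounds by (intro round_unique) (auto simp: A)
  then have "round_decimals 4 A = 0.6827"
    by (simp add: round_decimals_def)
  moreover have "(INF \<nu>\<in>{3..}. P \<nu>) = A"
  proof (rule antisym)
    have bdd: "bdd_below (P ` {3..})"
      using lower by (intro bdd_belowI2[where m = A]) (auto intro: less_imp_le)
    show "A \<le> (INF \<nu>\<in>{3..}. P \<nu>)"
      using lower by (intro cINF_greatest) (auto intro: less_imp_le)
    \<comment> \<open>The infimum lies below each \<open>P \<nu>\<close>, hence below these upper
      bounds, and therefore below their limit \<open>A\<close>.\<close>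
    have "(\<lambda>\<nu>. A + 2 * std_normal_density 1 / (real \<nu> - 2)) \<longlonglongrightarrow> A"
      by real_asymp
    moreover have "\<forall>\<^sub>F \<nu> in sequentially.
        (INF \<nu>\<in>{3..}. P \<nu>) \<le> A + 2 * std_normal_density 1 / (real \<nu> - 2)"
      using eventually_ge_at_top[of 3]
      by eventually_elim (use upper bdd in \<open>auto intro: cINF_lower2\<close>)
    ultimately show "(INF \<nu>\<in>{3..}. P \<nu>) \<le> A"
      by (rule tendsto_lowerbound) simp
  qed
  ultimately show ?thesis
    using lower by (simp add: A_def P_def)
qed

end
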